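(* Let $\Pi$ be a finite poset. Then the order polytope $\mathcal{O}(\Pi)$ is indecomposable if and only if the comparability graph $\mathrm{Comp}(\Pi)$ is connected.
   Context: Write $\Pi=([n],\preceq)$ with $[n]=\{1,\dots,n\}$. The order polytope is $\mathcal{O}(\Pi)=\{x\in[0,1]^n: x_a\le x_b \text{ for all } a\prec b\}$. The comparability graph $\mathrm{Comp}(\Pi)$ is the undirected simple graph on $[n]$ with edges $ab$ if $a\prec b$ or $b\prec a$. The Minkowski sum is $Q+R=\{q+r: q\in Q, r\in R\}$. Two polytopes are homothetic if they are related by translation and positive dilation. A polytope $P$ is decomposable if there are polytopes $Q,R$ with $P=Q+R$ such that neither $Q$ nor $R$ is homothetic to $P$; otherwise $P$ is indecomposable. *)

theory Defs
  imports "HOL-Analysis.Analysis" "HOL-Library.Set_Algebras"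
    "Graph_Theory.Digraph_Component"
begin

text \<open>
  A poset on \<open>n \<ge> 1\<close> elements is a relation \<open>r\<close> on a finite type \<open>'n\<close> with
  \<^prop>\<open>partial_order_on UNIV r\<close>, where \<open>(a, b) \<in> r\<close> means \<open>a \<preceq> b\<close>.
\<close>

definition strictly_below :: "'n rel \<Rightarrow> 'n \<Rightarrow> 'n \<Rightarrow> bool" where
  "strictly_below r a b \<longleftrightarrow> (a, b) \<in> r \<and> a \<noteq> b"

definition order_polytope :: "'n::finite rel \<Rightarrow> (real ^ 'n) set" where
  "order_polytope r =
     {x. (\<forall>a. x $ a \<in> {0..1}) \<and> (\<forall>a b. strictly_below r a b \<longrightarrow> x $ a \<le> x $ b)}"

text \<open>
  An undirected simple graph is a finite symmetric loop-free digraph without parallel arcs, i.e. the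
  locale \<^locale>\<open>graph\<close>: the edge \<open>ab\<close> is the pair of arcs \<open>(a, b)\<close> and \<open>(b, a)\<close>.
\<close>

definition comparability_graph :: "'n rel \<Rightarrow> ('n, 'n \<times> 'n) pre_digraph" where
  "comparability_graph r =
     \<lparr> verts = UNIV, arcs = {(a, b). strictly_below r a b \<or> strictly_below r b a},
       tail = fst, head = snd \<rparr>"

definition homothetic :: "'a::real_vector set \<Rightarrow> 'a set \<Rightarrow> bool" where
  "homothetic P Q \<longleftrightarrow> (\<exists>c::real. \<exists>t. c > 0 \<and> Q = (\<lambda>x. t + c *\<^sub>R x) ` P)"

text \<open>In \<open>Q + R\<close> the operation is the elementwise (Minkowski) sum of sets.\<close>

definition decomposable :: "'a::euclidean_space set \<Rightarrow> bool" where
  "decomposable P \<longleftrightarrow>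
     (\<exists>Q R. polytope Q \<and> polytope R \<and> P = Q + R \<and> \<not> homothetic Q P \<and> \<not> homothetic R P)"

definition indecomposable :: "'a::euclidean_space set \<Rightarrow> bool" where
  "indecomposable P \<longleftrightarrow> \<not> decomposable P"

lemma polytope_order_polytope: "polytope (order_polytope r)"
proof -
  have eq: "order_polytope r = cbox 0 1 \<inter>
      (\<Inter>(a, b) \<in> {(a, b). strictly_below r a b}. {x. (axis a 1 - axis b 1) \<bullet> x \<le> 0})"
    by (auto simp: order_polytope_def mem_box_cart inner_diff_left inner_axis' split: prod.splits)
  have "polyhedron (order_polytope r)"
    unfolding eq
    by (intro polyhedron_Int polyhedron_interval polyhedron_Inter)
       (auto simp: polyhedron_halfspace_le)
  moreover have "bounded (order_polytope r)"
    unfolding eq by (rule bounded_subset[OF bounded_cbox]) blast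
  ultimately show ?thesis
    by (simp add: polytope_eq_bounded_polyhedron)
qed

lemma graph_comparability_graph: "graph (comparability_graph (r :: 'n::finite rel))"
  by unfold_locales
     (auto simp: comparability_graph_def strictly_below_def arc_to_ends_def symmetric_def
       arcs_ends_def sym_def image_iff)

end

theory Submission
  imports Defs
begin

text \<open>
  Write \<open>P\<close> for the order polytope and \<open>0\<close>, \<open>1\<close> for the constant vectors, which both lie in \<open>P\<close>.

  Suppose that \<open>P = Q + R\<close>, and decompose \<open>0 = l + m\<close> and \<open>1 = u + v\<close> with \<open>l, u \<in> Q\<close> and
  \<open>m, v \<in> R\<close>. All defining inequalities of \<open>P\<close> are tight at \<open>0\<close> or at \<open>1\<close>: the bounds
  \<open>0 \<le> x\<^sub>a\<close> at \<open>0\<close>, the bounds \<open>x\<^sub>a \<le> 1\<close> at \<open>1\<close>, and the order relations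
  \<open>x\<^sub>a \<le> x\<^sub>b\<close> at both. A functional that is minimal over \<open>Q + R\<close> at a sum is minimal over each summand
  at the corresponding term. Hence \<open>l\<^sub>a \<le> x\<^sub>a \<le> u\<^sub>a\<close> on \<open>Q\<close>, and for \<open>a \<prec> b\<close> the
  functional \<open>x\<^sub>b - x\<^sub>a\<close> attains its minimum over \<open>Q\<close> both at \<open>l\<close> and at \<open>u\<close>. The latter says
  \<open>u\<^sub>a - l\<^sub>a = u\<^sub>b - l\<^sub>b\<close>, so if the comparability graph is connected, then \<open>u - l\<close> is a constant
  vector \<open>d 1\<close>, and all these inequalities together say \<open>Q \<subseteq> l + d P\<close>
  (\<open>summand_subset_homothet\<close>). In the same way \<open>R \<subseteq> m + (1 - d) P\<close>. As every extreme point
  of \<open>P\<close> has to be a sum of points of \<open>Q\<close> and \<open>R\<close>, these inclusions leave no room, and they are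
  equalities (\<open>summand_eq_homothet\<close>); so \<open>Q\<close> is homothetic to \<open>P\<close> if \<open>d > 0\<close>, and \<open>R\<close> is if
  \<open>d < 1\<close>.

  Conversely, a union \<open>C\<close> of components, other than \<open>\<emptyset>\<close> and the whole vertex set, splits \<open>P\<close>
  into the points supported on \<open>C\<close> and the points supported on its complement. Each of these
  summands has a coordinate that vanishes on it, whereas no coordinate is constant on \<open>P\<close>.
\<close>

section \<open>Connectivity and cuts\<close>

text \<open>
  This form of connectivity serves both directions: a function that agrees on comparable elements is
  constant (take for \<open>C\<close> one of its level sets), and a disconnected graph yields a cut \<open>C\<close>.
\<close>

lemma connected_comparability_graph_iff_no_cut:
  "Digraph_Component.connected (comparability_graph r) \<longleftrightarrow>
    (\<forall>C. (\<forall>a b. strictly_below r a b \<longrightarrow> (a \<in> C \<longleftrightarrow> b \<in> C)) \<longrightarrow> C = {} \<or> C = UNIV)"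
    (is "?conn \<longleftrightarrow> (\<forall>C. ?closed C \<longrightarrow> ?trivial C)")
proof -
  define E where "E = (arcs_ends (comparability_graph r))\<^sup>s"
  have E: "(a, b) \<in> E \<longleftrightarrow> strictly_below r a b \<or> strictly_below r b a" for a b
    by (force simp: E_def symcl_def comparability_graph_def arcs_ends_conv)
  have verts: "verts (comparability_graph r) = UNIV"
    by (simp add: comparability_graph_def)
  have "?conn \<longleftrightarrow> (\<forall>u v. (u, v) \<in> E\<^sup>*)"
    unfolding connected_conv verts E_def
    by (auto simp: rtrancl_consistent_rtrancl_on intro: rtrancl_on_rtranclI
        dest: rtrancl_on_sub_rtrancl[THEN subsetD])
  also have "\<dots> \<longleftrightarrow> (\<forall>C. ?closed C \<longrightarrow> ?trivial C)"
  proof (intro iffI allI impI)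
    fix C assume reach: "\<forall>u v. (u, v) \<in> E\<^sup>*" and closed: "?closed C"
    have "v \<in> C" if "u \<in> C" for u v
    proof -
      from reach have "(u, v) \<in> E\<^sup>*" by blast
      then show ?thesis
        by induction (use that E closed in blast)+
    qed
    then show "?trivial C" by blast
  next
    fix u v assume cut: "\<forall>C. ?closed C \<longrightarrow> ?trivial C"
    have "?closed {w. (u, w) \<in> E\<^sup>*}"
      using E by (blast intro: rtrancl.rtrancl_into_rtrancl)
    with cut have "{w. (u, w) \<in> E\<^sup>*} = {} \<or> {w. (u, w) \<in> E\<^sup>*} = UNIV" by blast
    then show "(u, v) \<in> E\<^sup>*" by blast
  qed
  finally show ?thesis .
qed

section \<open>Minkowski summands and homothety\<close>

lemma homothetic_sym:
  assumes "homothetic P Q"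
  shows "homothetic Q P"
proof -
  obtain c t where c: "c > 0" and Q: "Q = (\<lambda>x. t + c *\<^sub>R x) ` P"
    using assms by (auto simp: homothetic_def)
  have "P = (\<lambda>x. - (inverse c *\<^sub>R t) + inverse c *\<^sub>R x) ` Q"
    using c by (simp add: Q image_image algebra_simps)
  then show ?thesis
    unfolding homothetic_def
    using c by (intro exI[of _ "inverse c"] exI[of _ "- (inverse c *\<^sub>R t)"] conjI) simp_all
qed

text \<open>
  An extreme point \<open>p\<close> of \<open>P\<close> is a sum of a point \<open>l + d p1\<close> of \<open>Q\<close> and a point
  \<open>- l + (1 - d) p2\<close> of \<open>R\<close>. Then \<open>p = d p1 + (1 - d) p2\<close>, and extremality forces \<open>p1 = p\<close>. So
  \<open>Q\<close> contains the image of every extreme point, and by Krein-Milman that of all of \<open>P\<close>.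
\<close>

lemma summand_eq_homothet:
  fixes P Q R :: "'a::euclidean_space set"
  assumes P: "compact P" "convex P" and "convex Q" and sum: "P = Q + R"
    and d: "0 < d" "d \<le> 1"
    and Q: "Q \<subseteq> (\<lambda>p. l + d *\<^sub>R p) ` P"
    and R: "R \<subseteq> (\<lambda>p. - l + (1 - d) *\<^sub>R p) ` P"
  shows "Q = (\<lambda>p. l + d *\<^sub>R p) ` P"
proof
  let ?S = "{p. l + d *\<^sub>R p \<in> Q}"
  have "p \<in> ?S" if ext: "p extreme_point_of P" for p
  proof -
    have "p \<in> Q + R"
      using ext sum by (simp add: extreme_point_of_def)
    then obtain q s where q: "q \<in> Q" and s: "s \<in> R" and p: "p = q + s"
      by (auto elim: set_plus_elim)
    obtain p1 where p1: "p1 \<in> P" "q = l + d *\<^sub>R p1" using Q q by blast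
    obtain p2 where p2: "p2 \<in> P" "s = - l + (1 - d) *\<^sub>R p2" using R s by blast
    have comb: "p = d *\<^sub>R p1 + (1 - d) *\<^sub>R p2"
      by (simp add: p p1 p2)
    have "p = p1"
    proof (cases "d = 1 \<or> p1 = p2")
      case True
      then show ?thesis using comb by (auto simp: algebra_simps)
    next
      case False
      with d comb have "p \<in> open_segment p1 p2"
        by (auto simp: in_segment intro!: exI[of _ "1 - d"])
      with ext p1 p2 show ?thesis by (auto simp: extreme_point_of_def)
    qed
    with q p1 show ?thesis by simp
  qed
  moreover have "convex ?S"
  proof (rule convexI, unfold mem_Collect_eq)
    fix x y and \<alpha> \<beta> :: real
    assume xy: "l + d *\<^sub>R x \<in> Q" "l + d *\<^sub>R y \<in> Q" and ab: "0 \<le> \<alpha>" "0 \<le> \<beta>" "\<alpha> + \<beta> = 1"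
    have "l + d *\<^sub>R (\<alpha> *\<^sub>R x + \<beta> *\<^sub>R y) = (\<alpha> + \<beta>) *\<^sub>R l + d *\<^sub>R (\<alpha> *\<^sub>R x + \<beta> *\<^sub>R y)"
      by (simp add: ab)
    also have "\<dots> = \<alpha> *\<^sub>R (l + d *\<^sub>R x) + \<beta> *\<^sub>R (l + d *\<^sub>R y)"
      by (simp add: algebra_simps)
    also have "\<dots> \<in> Q"
      using xy ab \<open>convex Q\<close> by (simp add: convexD)
    finally show "l + d *\<^sub>R (\<alpha> *\<^sub>R x + \<beta> *\<^sub>R y) \<in> Q" .
  qed
  ultimately have "convex hull {p. p extreme_point_of P} \<subseteq> ?S"
    by (intro hull_minimal) auto
  with Krein_Milman_Minkowski[OF P] show "(\<lambda>p. l + d *\<^sub>R p) ` P \<subseteq> Q"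
    by auto
qed (rule Q)

section \<open>Summands of a connected order polytope\<close>

text \<open>
  The points \<open>l\<close> and \<open>u\<close> are the parts in \<open>Q\<close> of the constant vectors \<open>0\<close> and \<open>1\<close>. Each bound on
  \<open>Q\<close> in the proof comes from replacing \<open>l\<close> or \<open>u\<close> in these sums by another point of \<open>Q\<close>, which stays
  inside the order polytope.
\<close>

lemma summand_subset_homothet:
  fixes r :: "'n::finite rel"
  assumes conn: "Digraph_Component.connected (comparability_graph r)"
    and sum: "order_polytope r = Q + R"
    and l: "l \<in> Q" "m \<in> R" "l + m = 0"
    and u: "u \<in> Q" "v \<in> R" "u + v = 1"
  shows "\<exists>d\<ge>0. u - l = d *\<^sub>R 1 \<and> Q \<subseteq> (\<lambda>p. l + d *\<^sub>R p) ` order_polytope r"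
proof -
  have m: "m $ a = - l $ a" and v: "v $ a = 1 - u $ a" for a
    using arg_cong[OF l(3), of "\<lambda>x. x $ a"] arg_cong[OF u(3), of "\<lambda>x. x $ a"] by auto
  have low: "l $ a \<le> x $ a" and diff_l: "strictly_below r a b \<Longrightarrow> x $ a - l $ a \<le> x $ b - l $ b"
    if "x \<in> Q" for x a b
  proof -
    have "x + m \<in> order_polytope r"
      using that l sum by (simp add: set_plus_intro)
    then show "l $ a \<le> x $ a" "strictly_below r a b \<Longrightarrow> x $ a - l $ a \<le> x $ b - l $ b"
      by (auto simp: order_polytope_def m)
  qed
  have high: "x $ a \<le> u $ a" and diff_u: "strictly_below r a b \<Longrightarrow> x $ a - u $ a \<le> x $ b - u $ b"
    if "x \<in> Q" for x a b
  proof -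
    have "x + v \<in> order_polytope r"
      using that u sum by (simp add: set_plus_intro)
    then show "x $ a \<le> u $ a" "strictly_below r a b \<Longrightarrow> x $ a - u $ a \<le> x $ b - u $ b"
      by (auto simp: order_polytope_def v algebra_simps)
  qed
  obtain e :: 'n where True by blast
  define d where "d = u $ e - l $ e"
  have "u $ a - l $ a = u $ b - l $ b" if "strictly_below r a b" for a b
    using diff_l[OF u(1) that] diff_u[OF l(1) that] by linarith
  then have "\<forall>a b. strictly_below r a b \<longrightarrow>
      (a \<in> {a. u $ a - l $ a = d} \<longleftrightarrow> b \<in> {a. u $ a - l $ a = d})"
    by simp
  with conn have "{a. u $ a - l $ a = d} = {} \<or> {a. u $ a - l $ a = d} = UNIV"
    unfolding connected_comparability_graph_iff_no_cut by blast
  then have width: "u $ a - l $ a = d" for a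
    unfolding d_def by blast
  have d: "d \<ge> 0"
    using low[OF u(1), of e] by (simp add: d_def)
  have "x \<in> (\<lambda>p. l + d *\<^sub>R p) ` order_polytope r" if x: "x \<in> Q" for x
  proof (cases "d = 0")
    case True
    have "x $ a = l $ a" for a
      using True low[OF x, of a] high[OF x, of a] width[of a] by linarith
    then have "x = l"
      by (simp add: vec_eq_iff)
    moreover have "0 \<in> order_polytope r"
      by (simp add: order_polytope_def)
    ultimately show ?thesis using True by auto
  next
    case False
    have "x $ a - l $ a \<le> d" for a
      using high[OF x, of a] width[of a] by linarith
    then have "(1 / d) *\<^sub>R (x - l) \<in> order_polytope r"
      using d False low[OF x] diff_l[OF x]
      by (auto simp: order_polytope_def divide_simps)
    moreover have "x = l + d *\<^sub>R ((1 / d) *\<^sub>R (x - l))"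
      using False by simp
    ultimately show ?thesis by blast
  qed
  moreover have "u - l = d *\<^sub>R 1"
    using width by (simp add: vec_eq_iff)
  ultimately show ?thesis using d by blast
qed

lemma connected_imp_indecomposable:
  fixes r :: "'n::finite rel"
  assumes conn: "Digraph_Component.connected (comparability_graph r)"
  shows "indecomposable (order_polytope r)"
  unfolding indecomposable_def decomposable_def
proof clarify
  fix Q R
  assume Q: "polytope Q" "\<not> homothetic Q (order_polytope r)"
    and R: "polytope R" "\<not> homothetic R (order_polytope r)"
    and sum: "order_polytope r = Q + R"
  have sum': "order_polytope r = R + Q"
    using sum by (simp add: add.commute)
  have "0 \<in> Q + R" "1 \<in> Q + R"
    unfolding sum[symmetric] by (simp_all add: order_polytope_def)
  then obtain l m u v where l: "l \<in> Q" "m \<in> R" "l + m = 0" and u: "u \<in> Q" "v \<in> R" "u + v = 1"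
    by (metis set_plus_elim)
  then have l': "m + l = 0" and u': "v + u = 1"
    by (simp_all add: add.commute)
  obtain d where d: "d \<ge> 0" "u - l = d *\<^sub>R 1" "Q \<subseteq> (\<lambda>p. l + d *\<^sub>R p) ` order_polytope r"
    using summand_subset_homothet[OF conn sum l u] by blast
  obtain d' where d': "d' \<ge> 0" "v - m = d' *\<^sub>R 1" "R \<subseteq> (\<lambda>p. m + d' *\<^sub>R p) ` order_polytope r"
    using summand_subset_homothet[OF conn sum' l(2,1) l' u(2,1) u'] by blast
  have "(d + d') *\<^sub>R 1 = (u + v) - (l + m)"
    unfolding scaleR_left_distrib d(2)[symmetric] d'(2)[symmetric] by simp
  then have dd': "d + d' = 1"
    using l u by (simp add: vec_eq_iff)
  then have d_eq: "d = 1 - d'" and d'_eq: "d' = 1 - d"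
    by simp_all
  have m: "m = - l" and l_eq: "l = - m"
    using l by (simp_all add: eq_neg_iff_add_eq_0 add.commute)
  have P: "compact (order_polytope r)" "convex (order_polytope r)"
    using polytope_order_polytope
    by (auto intro: polytope_imp_compact polytope_imp_convex)
  show False
  proof (cases "d > 0")
    case True
    then have "Q = (\<lambda>p. l + d *\<^sub>R p) ` order_polytope r"
      using d(3) d'(1) dd' d'(3)[unfolded m d'_eq]
      by (intro summand_eq_homothet[OF P polytope_imp_convex[OF Q(1)] sum]) simp_all
    then have "homothetic (order_polytope r) Q"
      using True by (auto simp: homothetic_def)
    with Q show False by (blast intro: homothetic_sym)
  next
    case False
    then have "d = 0" "d' = 1" using d dd' by auto
    then have "R = (\<lambda>p. m + d' *\<^sub>R p) ` order_polytope r"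
      using d'(3) d(3)[unfolded l_eq d_eq]
      by (intro summand_eq_homothet[OF P polytope_imp_convex[OF R(1)] sum']) simp_all
    then have "homothetic (order_polytope r) R"
      unfolding homothetic_def using \<open>d' = 1\<close> zero_less_one by blast
    with R show False by (blast intro: homothetic_sym)
  qed
qed

section \<open>Splitting a disconnected order polytope\<close>

definition supported_on :: "'n set \<Rightarrow> (real ^ 'n::finite) set" where
  "supported_on C = {x. \<forall>a. a \<notin> C \<longrightarrow> x $ a = 0}"

lemma polyhedron_supported_on: "polyhedron (supported_on C)"
proof -
  have "supported_on C = (\<Inter>a\<in>- C. {x. axis a 1 \<bullet> x = 0})"
    by (auto simp: supported_on_def inner_axis')
  then show ?thesis
    by (auto intro: polyhedron_hyperplane)
qed

lemma order_polytope_eq_sum_supported_on: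
  assumes closed: "\<forall>a b. strictly_below r a b \<longrightarrow> (a \<in> C \<longleftrightarrow> b \<in> C)"
  shows "order_polytope r =
    (order_polytope r \<inter> supported_on C) + (order_polytope r \<inter> supported_on (- C))"
    (is "?P = ?Q + ?R")
proof
  show "?P \<subseteq> ?Q + ?R"
  proof
    fix x assume x: "x \<in> ?P"
    define y z where "y = (\<chi> a. if a \<in> C then x $ a else 0)"
      and "z = (\<chi> a. if a \<in> C then 0 else x $ a)"
    have "y \<in> ?Q" "z \<in> ?R"
      using x closed by (auto simp: y_def z_def order_polytope_def supported_on_def)
    then have "y + z \<in> ?Q + ?R"
      by (rule set_plus_intro)
    moreover have "y + z = x"
      by (simp add: y_def z_def vec_eq_iff)
    ultimately show "x \<in> ?Q + ?R"
      by simp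
  qed
  show "?Q + ?R \<subseteq> ?P"
  proof
    fix x assume "x \<in> ?Q + ?R"
    then obtain q s where q: "q \<in> ?Q" and s: "s \<in> ?R" and x: "x = q + s"
      by (elim set_plus_elim)
    have "x $ a = (if a \<in> C then q $ a else s $ a)" for a
      using q s by (simp add: x supported_on_def)
    then show "x \<in> ?P"
      using q s closed by (simp add: order_polytope_def)
  qed
qed

lemma not_homothetic_order_polytope_of_zero_coordinate:
  fixes r :: "'n::finite rel"
  assumes zero: "\<And>x. x \<in> Q \<Longrightarrow> x $ a = 0"
  shows "\<not> homothetic Q (order_polytope r)"
proof
  assume "homothetic Q (order_polytope r)"
  then obtain c t where P: "order_polytope r = (\<lambda>x. t + c *\<^sub>R x) ` Q"
    by (auto simp: homothetic_def)
  have const: "x $ a = t $ a" if "x \<in> order_polytope r" for x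
    using that zero by (auto simp: P)
  have "0 \<in> order_polytope r" "1 \<in> order_polytope r"
    by (simp_all add: order_polytope_def)
  then show False
    using const[of 0] const[of 1] by simp
qed

lemma decomposable_of_not_connected:
  assumes "\<not> Digraph_Component.connected (comparability_graph r)"
  shows "decomposable (order_polytope r)"
proof -
  obtain C where closed: "\<forall>a b. strictly_below r a b \<longrightarrow> (a \<in> C \<longleftrightarrow> b \<in> C)"
    and "C \<noteq> {}" "C \<noteq> UNIV"
    using assms unfolding connected_comparability_graph_iff_no_cut by blast
  then obtain a b where ab: "a \<in> C" "b \<notin> C" by blast
  let ?Q = "order_polytope r \<inter> supported_on C"
  let ?R = "order_polytope r \<inter> supported_on (- C)"
  have "polytope ?Q" "polytope ?R"
    by (simp_all add: polytope_Int_polyhedron polytope_order_polytope polyhedron_supported_on)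
  moreover have "\<not> homothetic ?Q (order_polytope r)"
    using ab by (intro not_homothetic_order_polytope_of_zero_coordinate[of _ b])
      (simp add: supported_on_def)
  moreover have "\<not> homothetic ?R (order_polytope r)"
    using ab by (intro not_homothetic_order_polytope_of_zero_coordinate[of _ a])
      (simp add: supported_on_def)
  ultimately show ?thesis
    unfolding decomposable_def using order_polytope_eq_sum_supported_on[OF closed] by blast
qed

theorem theorem4p14:
  fixes r :: "'n::finite rel"
  assumes "partial_order_on UNIV r"
  shows "indecomposable (order_polytope r) \<longleftrightarrow>
    Digraph_Component.connected (comparability_graph r)"
  using connected_imp_indecomposable decomposable_of_not_connected
  unfolding indecomposable_def by blast

end
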